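(* Let $\mathcal{L}_Q$ (states $Q$) be an LTS satisfying cn-enabled, let $\mathcal{T}$ be an LTS of tests such that the label abstraction $\mathbb{A}$ abstracts $(\mathcal{L}_Q,\mathcal{T})$, and let $\mathcal{L}_P$ (states $P$) be any LTS. For all sets $X\subseteq P$, $Y\subseteq Q$ with $X\sqsubseteq^{set}_{\mathbb{A}}Y$, and every test $t$ of $\mathcal{T}$: if $t$ is not good and $\mathrm{Must}_{set}(X,t)$, then for every $q\in Y$ we have $(q,t)\to$ (the composition of $q$ and $t$ can perform a step).
   Context: $\mathsf{Act}$ visible actions, $\tau\notin\mathsf{Act}$, $\mathsf{L}=\mathsf{Act}\cup\{\tau\}$, involutive duality $\mu\mapsto\overline{\mu}$; $N\subseteq\mathsf{Act}$ non-blocking, $B=\mathsf{Act}\setminus N$. LTSs are finite-image. cn-enabled: every state $p$ and $\eta\in N$ have $q$ with $p\xrightarrow{\overline{\eta}}q$. Composition of program state $p$ and test $t$: $(p,t)\to(p',t)$ if $p\xrightarrow{\tau}p'$; $(p,t)\to(p,t')$ if $t\xrightarrow{\tau}t'$; $(p,t)\to(p',t')$ if $p\xrightarrow{\overline{\mu}}p'$, $t\xrightarrow{\mu}t'$, $\mu\in\mathsf{Act}$. good is a decidable predicate on tests preserved in both directions by $N$-transitions. Must$(p,t)$ iff every maximal computation from $(p,t)$ contains a state with good test; $\mathrm{Must}_{set}(Z,t)$ iff Must$(p,t)$ for all $p\in Z$. $R(t)=\{\mu:t\xrightarrow{\mu}\}$, $\mathrm{coR}(p)=\{\beta\in B:p\xrightarrow{\overline{\beta}}\}$.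 Label abstraction $\mathbb{A}=(\phi:B\to Y',\delta:Y'\to X_{\mathbb{A}})$, $\mathrm{coR}_{\mathbb{A}}(p)=\{\delta(\phi(\beta)):\beta\in\mathrm{coR}(p)\}$; $\mathbb{A}$ abstracts $(\mathcal{L}_Q,\mathcal{T})$ if for all $\beta,\beta'\in B$: (i) for each test $t$, $\phi(\beta)=\phi(\beta')$ and $\beta\in R(t)$ imply $\beta'\in R(t)$; (ii) for each $q\in Q$, $\delta(\phi(\beta))=\delta(\phi(\beta'))$ and $\phi(\beta)\in\phi(\mathrm{coR}(q))$ imply $\phi(\beta')\in\phi(\mathrm{coR}(q))$. For an LTS, $\mathsf{toSet}$ has subsets of states as states and $Z\xrightarrow{\alpha}\{q:\exists p\in Z.\,p\xrightarrow{\alpha}q\}$; $\Downarrow s$ (convergence): no state reached via a weak transition along a prefix of $s$ has an infinite $\tau$-sequence. $\mathrm{ws}(p,s)=\{q:p\overset{s}{\Rightarrow}q\not\xrightarrow{\tau}\}$, $[\![p]\!](s)=\{\mathrm{coR}_{\mathbb{A}}(q):q\in\mathrm{ws}(p,s)\}$, $[\![Z]\!]_{set}(s)=\bigcup_{p\in Z}[\![p]\!](s)$ (each computed in its own LTS). $\mathcal{A}\ll\mathcal{B}$ iff each $x\in\mathcal{B}$ has some $y\in\mathcal{A}$ with $y\subseteq x$. $X\sqsubseteq^{set}_{\mathbb{A}}Y$ iff for all $s\in\mathsf{Act}^*$, $X\Downarrow s$ implies $Y\Downarrow s$ and $[\![X]\!]_{set}(s)\ll[\![Y]\!]_{set}(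s)$.
   Formalization: Convergence of a set X along s is taken to mean that no member of a set reached in toSet has an infinite τ-sequence (equivalently, each p in X converges along s); read literally in toSet no set converges, since ∅ steps to ∅, and the claim fails. *)

theory Defs
  imports "HOL-Library.Sublist" "HOL-Library.Extended_Nat"
begin

text \<open>
  The visible actions are the elements of a type \<open>'a\<close>, with duality \<open>dual :: 'a \<Rightarrow> 'a\<close>. The
  non-blocking actions form a set \<open>N\<close>, and \<open>B\<close> is its complement. An LTS is its transition
  relation; its states are the elements of a type.
\<close>

datatype 'a label = Tau | Vis 'a

type_synonym ('s, 'a) lts = "'s \<Rightarrow> 'a label \<Rightarrow> 's \<Rightarrow> bool"

definition finite_image :: "('s, 'a) lts \<Rightarrow> bool" where
  "finite_image L \<longleftrightarrow> (\<forall>p \<alpha>. finite {q. L p \<alpha> q})"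

definition stable :: "('s, 'a) lts \<Rightarrow> 's \<Rightarrow> bool" where
  "stable L p \<longleftrightarrow> \<not> (\<exists>q. L p Tau q)"

definition cn_enabled :: "('a \<Rightarrow> 'a) \<Rightarrow> 'a set \<Rightarrow> ('s, 'a) lts \<Rightarrow> bool" where
  "cn_enabled dual N L \<longleftrightarrow> (\<forall>p. \<forall>\<eta>\<in>N. \<exists>q. L p (Vis (dual \<eta>)) q)"

definition good_preserved :: "'a set \<Rightarrow> ('t, 'a) lts \<Rightarrow> ('t \<Rightarrow> bool) \<Rightarrow> bool" where
  "good_preserved N T good \<longleftrightarrow> (\<forall>t t'. \<forall>\<eta>\<in>N. T t (Vis \<eta>) t' \<longrightarrow> (good t \<longleftrightarrow> good t'))"

inductive comp_step ::
  "('a \<Rightarrow> 'a) \<Rightarrow> ('p, 'a) lts \<Rightarrow> ('t, 'a) lts \<Rightarrow> 'p \<times> 't \<Rightarrow> 'p \<times> 't \<Rightarrow> bool"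
  for dual :: "'a \<Rightarrow> 'a" and L :: "('p, 'a) lts" and T :: "('t, 'a) lts"
where
  comp_program: "L p Tau p' \<Longrightarrow> comp_step dual L T (p, t) (p', t)"
| comp_test: "T t Tau t' \<Longrightarrow> comp_step dual L T (p, t) (p, t')"
| comp_sync: "L p (Vis (dual \<mu>)) p' \<Longrightarrow> T t (Vis \<mu>) t' \<Longrightarrow> comp_step dual L T (p, t) (p', t')"

text \<open>
  A computation with \<open>n\<close> steps, where \<open>n\<close> may be \<open>\<infinity>\<close>, visits exactly the states \<open>c i\<close> with
  \<open>enat i \<le> n\<close>. It is maximal if it is infinite or its last state has no step.
\<close>

definition max_computation :: "('c \<Rightarrow> 'c \<Rightarrow> bool) \<Rightarrow> 'c \<Rightarrow> (nat \<Rightarrow> 'c) \<Rightarrow> enat \<Rightarrow> bool" where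
  "max_computation step x c n \<longleftrightarrow>
     c 0 = x \<and>
     (\<forall>i. enat i < n \<longrightarrow> step (c i) (c (Suc i))) \<and>
     (\<forall>k. n = enat k \<longrightarrow> \<not> (\<exists>y. step (c k) y))"

definition Must ::
  "('a \<Rightarrow> 'a) \<Rightarrow> ('p, 'a) lts \<Rightarrow> ('t, 'a) lts \<Rightarrow> ('t \<Rightarrow> bool) \<Rightarrow> 'p \<Rightarrow> 't \<Rightarrow> bool" where
  "Must dual L T good p t \<longleftrightarrow>
     (\<forall>c n. max_computation (comp_step dual L T) (p, t) c n \<longrightarrow>
        (\<exists>i. enat i \<le> n \<and> good (snd (c i))))"

definition Must_set ::
  "('a \<Rightarrow> 'a) \<Rightarrow> ('p, 'a) lts \<Rightarrow> ('t, 'a) lts \<Rightarrow> ('t \<Rightarrow> bool) \<Rightarrow> 'p set \<Rightarrow> 't \<Rightarrow> bool" where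
  "Must_set dual L T good Z t \<longleftrightarrow> (\<forall>p\<in>Z. Must dual L T good p t)"

definition R :: "('t, 'a) lts \<Rightarrow> 't \<Rightarrow> 'a set" where
  "R T t = {\<mu>. \<exists>t'. T t (Vis \<mu>) t'}"

definition coR :: "('a \<Rightarrow> 'a) \<Rightarrow> 'a set \<Rightarrow> ('p, 'a) lts \<Rightarrow> 'p \<Rightarrow> 'a set" where
  "coR dual N L p = {\<beta>. \<beta> \<in> - N \<and> (\<exists>q. L p (Vis (dual \<beta>)) q)}"

text \<open>The values of \<open>lphi\<close> outside \<open>B = - N\<close> are never used.\<close>

record ('a, 'y, 'x) label_abs =
  lphi :: "'a \<Rightarrow> 'y"
  ldelta :: "'y \<Rightarrow> 'x"

definition coR_abs ::
  "('a, 'y, 'x) label_abs \<Rightarrow> ('a \<Rightarrow> 'a) \<Rightarrow> 'a set \<Rightarrow> ('p, 'a) lts \<Rightarrow> 'p \<Rightarrow> 'x set" where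
  "coR_abs A dual N L p = {ldelta A (lphi A \<beta>) | \<beta>. \<beta> \<in> coR dual N L p}"

definition abstracts ::
  "('a, 'y, 'x) label_abs \<Rightarrow> ('a \<Rightarrow> 'a) \<Rightarrow> 'a set \<Rightarrow> ('q, 'a) lts \<Rightarrow> ('t, 'a) lts \<Rightarrow> bool" where
  "abstracts A dual N L T \<longleftrightarrow>
     (\<forall>\<beta>\<in>- N. \<forall>\<beta>'\<in>- N.
        (\<forall>t. lphi A \<beta> = lphi A \<beta>' \<longrightarrow> \<beta> \<in> R T t \<longrightarrow> \<beta>' \<in> R T t) \<and>
        (\<forall>q. ldelta A (lphi A \<beta>) = ldelta A (lphi A \<beta>') \<longrightarrow>
             lphi A \<beta> \<in> lphi A ` coR dual N L q \<longrightarrow> lphi A \<beta>' \<in> lphi A ` coR dual N L q))"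

inductive weak :: "('s, 'a) lts \<Rightarrow> 's \<Rightarrow> 'a list \<Rightarrow> 's \<Rightarrow> bool" for L :: "('s, 'a) lts" where
  weak_refl: "weak L p [] p"
| weak_tau: "L p Tau q \<Longrightarrow> weak L q s r \<Longrightarrow> weak L p s r"
| weak_vis: "L p (Vis a) q \<Longrightarrow> weak L q s r \<Longrightarrow> weak L p (a # s) r"

definition ws :: "('s, 'a) lts \<Rightarrow> 's \<Rightarrow> 'a list \<Rightarrow> 's set" where
  "ws L p s = {q. weak L p s q \<and> stable L q}"

definition beh ::
  "('a, 'y, 'x) label_abs \<Rightarrow> ('a \<Rightarrow> 'a) \<Rightarrow> 'a set \<Rightarrow> ('p, 'a) lts \<Rightarrow> 'p \<Rightarrow> 'a list \<Rightarrow> 'x set set" where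
  "beh A dual N L p s = {coR_abs A dual N L q | q. q \<in> ws L p s}"

definition beh_set ::
  "('a, 'y, 'x) label_abs \<Rightarrow> ('a \<Rightarrow> 'a) \<Rightarrow> 'a set \<Rightarrow> ('p, 'a) lts \<Rightarrow> 'p set \<Rightarrow> 'a list \<Rightarrow> 'x set set"
where
  "beh_set A dual N L Z s = (\<Union>p\<in>Z. beh A dual N L p s)"

definition below :: "'x set set \<Rightarrow> 'x set set \<Rightarrow> bool" where
  "below \<A> \<B> \<longleftrightarrow> (\<forall>x\<in>\<B>. \<exists>y\<in>\<A>. y \<subseteq> x)"

definition diverges :: "('s, 'a) lts \<Rightarrow> 's \<Rightarrow> bool" where
  "diverges L p \<longleftrightarrow> (\<exists>f. f 0 = p \<and> (\<forall>i::nat. L (f i) Tau (f (Suc i))))"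

definition converges :: "('s, 'a) lts \<Rightarrow> 's \<Rightarrow> 'a list \<Rightarrow> bool" where
  "converges L p s \<longleftrightarrow> (\<forall>u q. prefix u s \<longrightarrow> weak L p u q \<longrightarrow> \<not> diverges L q)"

definition toSet :: "('s, 'a) lts \<Rightarrow> ('s set, 'a) lts" where
  "toSet L Z \<alpha> Z' \<longleftrightarrow> Z' = {q. \<exists>p\<in>Z. L p \<alpha> q}"

text \<open>
  Convergence of a set follows the weak transitions of \<open>toSet L\<close> and forbids that a state in a
  reached set has an infinite sequence of \<open>Tau\<close> steps of \<open>L\<close>. Forbidding infinite sequences of
  \<open>Tau\<close> steps between sets would not do: in \<open>toSet L\<close> every set has one, since the empty set steps
  to itself (\<open>not_converges_toSet\<close>). If only steps to non-empty sets are kept, an infinite set of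
  states that perform \<open>Tau\<close> steps arbitrarily long but not infinitely often would still diverge.
  For finite sets that variant agrees with the present definition
  (\<open>converges_set_iff_toSet_nonempty\<close>).
\<close>

definition converges_set :: "('s, 'a) lts \<Rightarrow> 's set \<Rightarrow> 'a list \<Rightarrow> bool" where
  "converges_set L X s \<longleftrightarrow>
     (\<forall>u Z. prefix u s \<longrightarrow> weak (toSet L) X u Z \<longrightarrow> (\<forall>q\<in>Z. \<not> diverges L q))"

definition set_preorder ::
  "('a, 'y, 'x) label_abs \<Rightarrow> ('a \<Rightarrow> 'a) \<Rightarrow> 'a set \<Rightarrow> ('p, 'a) lts \<Rightarrow> ('q, 'a) lts \<Rightarrow>
   'p set \<Rightarrow> 'q set \<Rightarrow> bool" where
  "set_preorder A dual N L\<^sub>P L\<^sub>Q X Y \<longleftrightarrow>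
     (\<forall>s. converges_set L\<^sub>P X s \<longrightarrow>
        converges_set L\<^sub>Q Y s \<and> below (beh_set A dual N L\<^sub>P X s) (beh_set A dual N L\<^sub>Q Y s))"

lemma not_converges_toSet: "\<not> converges (toSet L) X s"
proof -
  define f where "f i = ((\<lambda>Z. {q. \<exists>p\<in>Z. L p Tau q}) ^^ i) X" for i
  have "diverges (toSet L) X"
    unfolding diverges_def by (rule exI[of _ f]) (simp add: f_def toSet_def)
  then show ?thesis
    unfolding converges_def by (meson Nil_prefix weak_refl)
qed

definition toSet_nonempty :: "('s, 'a) lts \<Rightarrow> ('s set, 'a) lts" where
  "toSet_nonempty L Z \<alpha> Z' \<longleftrightarrow> toSet L Z \<alpha> Z' \<and> Z' \<noteq> {}"

lemma weak_toSet_member: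
  assumes "weak (toSet L) X u Z" "q \<in> Z"
  shows "\<exists>p\<in>X. weak L p u q"
  using assms
proof (induction rule: weak.induct)
  case (weak_refl X)
  then show ?case by (auto intro: weak.intros)
next
  case (weak_tau X X' s Z)
  then obtain p' where p': "p' \<in> X'" "weak L p' s q" by blast
  with weak_tau.hyps(1) obtain p where "p \<in> X" "L p Tau p'" by (auto simp: toSet_def)
  with p' show ?case by (blast intro: weak.intros)
next
  case (weak_vis X a X' s Z)
  then obtain p' where p': "p' \<in> X'" "weak L p' s q" by blast
  with weak_vis.hyps(1) obtain p where "p \<in> X" "L p (Vis a) p'" by (auto simp: toSet_def)
  with p' show ?case by (blast intro: weak.intros)
qed

lemma weak_toSet_nonempty_imp: "weak (toSet_nonempty L) X u Z \<Longrightarrow> weak (toSet L) X u Z"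
  by (induction rule: weak.induct) (auto simp: toSet_nonempty_def intro: weak.intros)

lemma weak_member_toSet_nonempty:
  assumes "weak L p u q" "p \<in> X"
  shows "\<exists>Z. weak (toSet_nonempty L) X u Z \<and> q \<in> Z"
  using assms
proof (induction arbitrary: X rule: weak.induct)
  case (weak_refl p)
  then show ?case by (auto intro: weak.intros)
next
  case (weak_tau p p' s r)
  let ?X' = "{q. \<exists>p\<in>X. L p Tau q}"
  have "p' \<in> ?X'" using weak_tau by auto
  then have "toSet_nonempty L X Tau ?X'" by (auto simp: toSet_nonempty_def toSet_def)
  with weak_tau.IH[OF \<open>p' \<in> ?X'\<close>] show ?case by (auto intro: weak.intros)
next
  case (weak_vis p a p' s r)
  let ?X' = "{q. \<exists>p\<in>X. L p (Vis a) q}"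
  have "p' \<in> ?X'" using weak_vis by auto
  then have "toSet_nonempty L X (Vis a) ?X'" by (auto simp: toSet_nonempty_def toSet_def)
  with weak_vis.IH[OF \<open>p' \<in> ?X'\<close>] show ?case by (auto intro: weak.intros)
qed

lemma converges_set_iff_members: "converges_set L X s \<longleftrightarrow> (\<forall>p\<in>X. converges L p s)"
proof
  assume *: "converges_set L X s"
  show "\<forall>p\<in>X. converges L p s"
    unfolding converges_def
  proof (intro ballI allI impI)
    fix p u q assume "p \<in> X" "prefix u s" "weak L p u q"
    moreover from this obtain Z where "weak (toSet_nonempty L) X u Z" "q \<in> Z"
      using weak_member_toSet_nonempty[of L p u q X] by blast
    moreover from this(1) have "weak (toSet L) X u Z" by (rule weak_toSet_nonempty_imp)
    ultimately show "\<not> diverges L q" using * unfolding converges_set_def by blast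
  qed
next
  assume *: "\<forall>p\<in>X. converges L p s"
  show "converges_set L X s"
    unfolding converges_set_def
  proof (intro ballI allI impI)
    fix u Z q assume "prefix u s" "weak (toSet L) X u Z" "q \<in> Z"
    moreover from this obtain p where "p \<in> X" "weak L p u q"
      using weak_toSet_member[of L X u Z q] by blast
    ultimately show "\<not> diverges L q" using * unfolding converges_def by blast
  qed
qed

lemma finite_toSet: "finite_image L \<Longrightarrow> finite Z \<Longrightarrow> toSet L Z \<alpha> Z' \<Longrightarrow> finite Z'"
proof -
  assume "finite_image L" "finite Z" "toSet L Z \<alpha> Z'"
  moreover have "{q. \<exists>p\<in>Z. L p \<alpha> q} = (\<Union>p\<in>Z. {q. L p \<alpha> q})" by auto
  ultimately show ?thesis by (auto simp: toSet_def finite_image_def)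
qed

lemma finite_weak_toSet:
  assumes "finite_image L"
  shows "weak (toSet L) X u Z \<Longrightarrow> finite X \<Longrightarrow> finite Z"
  by (induction rule: weak.induct) (auto dest: finite_toSet[OF assms])

lemma diverges_toSet_nonempty_iff:
  assumes fi: "finite_image L" and fin: "finite Z"
  shows "diverges (toSet_nonempty L) Z \<longleftrightarrow> (\<exists>q\<in>Z. diverges L q)"
proof
  assume "\<exists>q\<in>Z. diverges L q"
  then obtain f where f: "f 0 \<in> Z" "\<And>i. L (f i) Tau (f (Suc i))"
    unfolding diverges_def by auto
  define F where "F i = ((\<lambda>Z. {q. \<exists>p\<in>Z. L p Tau q}) ^^ i) Z" for i
  have "f i \<in> F i" for i
    by (induction i) (use f in \<open>auto simp: F_def\<close>)
  then have "F i \<noteq> {}" for i by blast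
  moreover have "toSet L (F i) Tau (F (Suc i))" for i by (simp add: toSet_def F_def)
  ultimately have "toSet_nonempty L (F i) Tau (F (Suc i))" for i
    unfolding toSet_nonempty_def by blast
  moreover have "F 0 = Z" by (simp add: F_def)
  ultimately show "diverges (toSet_nonempty L) Z" unfolding diverges_def by blast
next
  define long where "long p n \<longleftrightarrow> (\<exists>q. ((\<lambda>p q. L p Tau q) ^^ n) p q)" for p n
  have long_Suc: "long p (Suc n) \<longleftrightarrow> (\<exists>q. L p Tau q \<and> long q n)" for p n
    unfolding long_def by (metis relpowp_Suc_D2 relpowp_Suc_I2)
  have long_mono: "long p n" if "long p m" "n \<le> m" for p n m
    using that
  proof (induction n arbitrary: p m)
    case 0
    then show ?case by (auto simp: long_def)
  next
    case (Suc n)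
    then obtain m' where "m = Suc m'" "n \<le> m'" by (cases m) auto
    with Suc show ?case using long_Suc by metis
  qed
  have pigeon: "\<exists>p\<in>S. \<forall>n. long p n" if "finite S" and some: "\<And>n. \<exists>p\<in>S. long p n" for S
  proof (rule ccontr)
    assume "\<not> ?thesis"
    then obtain m where m: "\<And>p. p \<in> S \<Longrightarrow> \<not> long p (m p)" by metis
    obtain p where p: "p \<in> S" "long p (Max (m ` S))" using some by blast
    with \<open>finite S\<close> have "m p \<le> Max (m ` S)" by simp
    with p m long_mono show False by blast
  qed
  assume "diverges (toSet_nonempty L) Z"
  then obtain F where F: "F 0 = Z" "\<And>i. toSet_nonempty L (F i) Tau (F (Suc i))"
    unfolding diverges_def by auto
  have reach: "q \<in> F n \<Longrightarrow> \<exists>p\<in>Z. ((\<lambda>p q. L p Tau q) ^^ n) p q" for n q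
  proof (induction n arbitrary: q)
    case 0
    then show ?case using F by simp
  next
    case (Suc n)
    from F(2)[of n] Suc.prems obtain r where "r \<in> F n" "L r Tau q"
      by (auto simp: toSet_nonempty_def toSet_def)
    with Suc.IH show ?case by (meson relpowp_Suc_I)
  qed
  have ne: "F (Suc n) \<noteq> {}" for n using F(2) by (simp add: toSet_nonempty_def)
  have "\<exists>p\<in>Z. long p n" for n
  proof -
    obtain q where "q \<in> F (Suc n)" using ne by blast
    with reach have "\<exists>p\<in>Z. long p (Suc n)" unfolding long_def by blast
    then show ?thesis using long_mono[of _ "Suc n" n] by auto
  qed
  from pigeon[OF fin this] obtain p where p: "p \<in> Z" "\<forall>n. long p n" by blast
  have "\<exists>f. f 0 = p \<and> (\<forall>i. (\<forall>n. long (f i) n) \<and> L (f i) Tau (f (Suc i)))"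
  proof -
    have "\<exists>y. (\<forall>n. long y n) \<and> L x Tau y" if "\<forall>n. long x n" for x
    proof -
      have "\<exists>y\<in>{q. L x Tau q}. long y n" for n
        using that long_Suc[of x n] by auto
      with pigeon[of "{q. L x Tau q}"] fi show ?thesis unfolding finite_image_def by blast
    qed
    then have "\<exists>f. \<forall>i. ((\<forall>n. long (f i) n) \<and> (i = 0 \<longrightarrow> f i = p)) \<and> L (f i) Tau (f (Suc i))"
      using p by (intro dependent_nat_choice) auto
    then show ?thesis by blast
  qed
  with p show "\<exists>q\<in>Z. diverges L q" unfolding diverges_def by blast
qed

lemma converges_set_iff_toSet_nonempty:
  assumes "finite_image L" "finite X"
  shows "converges_set L X s \<longleftrightarrow> converges (toSet_nonempty L) X s"
proof
  assume *: "converges_set L X s"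
  show "converges (toSet_nonempty L) X s"
    unfolding converges_def
  proof (intro allI impI)
    fix u Z assume "prefix u s" "weak (toSet_nonempty L) X u Z"
    moreover from this(2) have "weak (toSet L) X u Z" by (rule weak_toSet_nonempty_imp)
    moreover from this have "finite Z" using finite_weak_toSet[OF assms(1) _ assms(2)] by blast
    ultimately show "\<not> diverges (toSet_nonempty L) Z"
      using * diverges_toSet_nonempty_iff[OF assms(1)] unfolding converges_set_def by blast
  qed
next
  assume *: "converges (toSet_nonempty L) X s"
  show "converges_set L X s"
    unfolding converges_set_iff_members converges_def
  proof (intro ballI allI impI)
    fix p u q assume "p \<in> X" "prefix u s" "weak L p u q"
    moreover from this obtain Z where Z: "weak (toSet_nonempty L) X u Z" "q \<in> Z"
      using weak_member_toSet_nonempty[of L p u q X] by blast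
    moreover have "finite Z"
      using finite_weak_toSet[OF assms(1) weak_toSet_nonempty_imp[OF Z(1)] assms(2)] .
    ultimately show "\<not> diverges L q"
      using * diverges_toSet_nonempty_iff[OF assms(1)] unfolding converges_def by blast
  qed
qed

end

theory Submission
  imports Defs
begin

text \<open>
  As \<open>t\<close> is not good, \<open>Must\<close> survives \<open>Tau\<close> steps of the program alone. Hence \<open>X\<close> converges along the
  empty trace, and \<open>(p, t)\<close> has a step for every stable \<open>p\<close> reached from \<open>X\<close>. If \<open>(q, t)\<close> were stuck
  for some \<open>q \<in> Y\<close>, then \<open>q\<close> would be stable, and the preorder at the empty trace would give such
  a \<open>p\<close> whose abstract co-ready set is contained in that of \<open>q\<close>. The step of \<open>(p, t)\<close> is then a
  synchronisation, which \<open>q\<close> can imitate: by \<open>cn_enabled\<close> for a non-blocking label, by the label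
  abstraction otherwise.
\<close>

text \<open>Prefixing a maximal computation from \<open>(p', t)\<close> with the \<open>Tau\<close>
  step gives one from \<open>(p, t)\<close> that is one step longer. Its good state cannot be the
  new first one, since \<open>t\<close> is not good.\<close>

lemma Must_program_tau:
  assumes "Must dual L T good p t" "\<not> good t" "L p Tau p'"
  shows "Must dual L T good p' t"
  unfolding Must_def
proof (intro allI impI)
  fix c n assume c: "max_computation (comp_step dual L T) (p', t) c n"
  let ?c = "case_nat (p, t) c"
  have "max_computation (comp_step dual L T) (p, t) ?c (eSuc n)"
    unfolding max_computation_def
  proof (intro conjI allI impI)
    show "?c 0 = (p, t)" by simp
  next
    fix i assume "enat i < eSuc n"
    with c assms(3) show "comp_step dual L T (?c i) (?c (Suc i))"
      by (cases i) (auto simp: max_computation_def comp_program simp flip: eSuc_enat)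
  next
    fix k assume "eSuc n = enat k"
    then obtain m where "k = Suc m" "n = enat m"
      by (cases n) (auto simp: eSuc_enat)
    with c show "\<not> (\<exists>y. comp_step dual L T (?c k) y)"
      by (simp add: max_computation_def)
  qed
  with assms(1) obtain i where i: "enat i \<le> eSuc n" "good (snd (?c i))"
    unfolding Must_def by blast
  with assms(2) obtain j where "i = Suc j" by (cases i) auto
  with i show "\<exists>i. enat i \<le> n \<and> good (snd (c i))"
    by (auto simp flip: eSuc_enat)
qed

text \<open>The trace is a variable with \<open>u = []\<close> so that rule induction applies; the
  visible case is then vacuous.\<close>

lemma Must_weak_Nil:
  assumes "weak L p u p'" "u = []" "Must dual L T good p t" "\<not> good t"
  shows "Must dual L T good p' t"
  using assms by (induction rule: weak.induct) (auto dest: Must_program_tau)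

text \<open>An infinite run of \<open>Tau\<close> steps of the program is an infinite computation
  along which the test stays \<open>t\<close>.\<close>

lemma Must_not_diverges:
  assumes "Must dual L T good p t" "\<not> good t"
  shows "\<not> diverges L p"
proof
  assume "diverges L p"
  then obtain f where "f 0 = p" "\<And>i. L (f i) Tau (f (Suc i))"
    unfolding diverges_def by auto
  then have "max_computation (comp_step dual L T) (p, t) (\<lambda>i. (f i, t)) \<infinity>"
    by (auto simp: max_computation_def intro: comp_program)
  with assms show False unfolding Must_def by fastforce
qed

lemma Must_has_step:
  assumes "Must dual L T good p t" "\<not> good t"
  shows "\<exists>c. comp_step dual L T (p, t) c"
proof (rule ccontr)
  assume "\<not> ?thesis"
  \<comment> \<open>With length \<open>0\<close> only index \<open>0\<close> is visited, so the
    values at later indices are irrelevant.\<close>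
  then have "max_computation (comp_step dual L T) (p, t) (\<lambda>_. (p, t)) 0"
    by (auto simp: max_computation_def)
  with assms show False unfolding Must_def by fastforce
qed

lemma abstracts_coR_R:
  assumes abs: "abstracts A dual N L T"
    and \<beta>: "\<beta> \<in> - N" "\<beta> \<in> R T t" "ldelta A (lphi A \<beta>) \<in> coR_abs A dual N L q"
  shows "\<exists>\<gamma>. \<gamma> \<in> coR dual N L q \<and> \<gamma> \<in> R T t"
proof -
  obtain \<gamma> where \<gamma>: "\<gamma> \<in> coR dual N L q" "ldelta A (lphi A \<gamma>) = ldelta A (lphi A \<beta>)"
    using \<beta>(3) unfolding coR_abs_def by auto
  have "\<gamma> \<in> - N" using \<gamma>(1) by (simp add: coR_def)
  \<comment> \<open>\<open>\<gamma>\<close> agrees with \<open>\<beta>\<close> only after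
    \<open>ldelta\<close>, too coarse for the test. The program condition of
    \<open>abstracts\<close> lifts this to agreement under \<open>lphi\<close>, where the test
    condition applies.\<close>
  with abs \<gamma> \<beta>(1) have "lphi A \<beta> \<in> lphi A ` coR dual N L q"
    unfolding abstracts_def by blast
  then obtain \<gamma>' where \<gamma>': "\<gamma>' \<in> coR dual N L q" "lphi A \<beta> = lphi A \<gamma>'" by blast
  then have "\<gamma>' \<in> - N" by (simp add: coR_def)
  with abs \<beta>(1,2) \<gamma>' have "\<gamma>' \<in> R T t" unfolding abstracts_def by blast
  with \<gamma>' show ?thesis by blast
qed

theorem lemma20:
  fixes dual :: "'a \<Rightarrow> 'a" and N :: "'a set"
    and L\<^sub>P :: "('p, 'a) lts" and L\<^sub>Q :: "('q, 'a) lts" and T :: "('t, 'a) lts"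
    and good :: "'t \<Rightarrow> bool"
    and A :: "('a, 'y, 'x) label_abs"
    and X :: "'p set" and Y :: "'q set" and t :: 't
  assumes "\<And>\<mu>. dual (dual \<mu>) = \<mu>"
    and "finite_image L\<^sub>P" and "finite_image L\<^sub>Q" and "finite_image T"
    and "good_preserved N T good"
    and "cn_enabled dual N L\<^sub>Q"
    and "abstracts A dual N L\<^sub>Q T"
    and "set_preorder A dual N L\<^sub>P L\<^sub>Q X Y"
    and "\<not> good t"
    and "Must_set dual L\<^sub>P T good X t"
  shows "\<forall>q\<in>Y. \<exists>c. comp_step dual L\<^sub>Q T (q, t) c"
proof
  fix q assume "q \<in> Y"
  have "converges_set L\<^sub>P X []"
    unfolding converges_set_iff_members converges_def
  proof (intro ballI allI impI)
    fix p u p' assume "p \<in> X" "prefix u []" "weak L\<^sub>P p u p'"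
    with assms(9,10) have "Must dual L\<^sub>P T good p' t"
      by (auto simp: Must_set_def intro: Must_weak_Nil)
    with assms(9) show "\<not> diverges L\<^sub>P p'" by (rule Must_not_diverges[rotated])
  qed
  with assms(8) have below: "below (beh_set A dual N L\<^sub>P X []) (beh_set A dual N L\<^sub>Q Y [])"
    unfolding set_preorder_def by blast
  show "\<exists>c. comp_step dual L\<^sub>Q T (q, t) c"
  proof (rule ccontr)
    assume stuck: "\<not> ?thesis"
    then have "stable L\<^sub>Q q" unfolding stable_def by (blast intro: comp_program)
    with \<open>q \<in> Y\<close> have "coR_abs A dual N L\<^sub>Q q \<in> beh_set A dual N L\<^sub>Q Y []"
      by (auto simp: beh_set_def beh_def ws_def intro: weak_refl)
    with below obtain p p' where p: "p \<in> X" "weak L\<^sub>P p [] p'" "stable L\<^sub>P p'"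
      and sub: "coR_abs A dual N L\<^sub>P p' \<subseteq> coR_abs A dual N L\<^sub>Q q"
      unfolding below_def by (fastforce simp: beh_set_def beh_def ws_def)
    have "Must dual L\<^sub>P T good p' t"
      using p assms(9,10) by (auto simp: Must_set_def intro: Must_weak_Nil)
    from Must_has_step[OF this assms(9)] obtain c where "comp_step dual L\<^sub>P T (p', t) c" ..
    then show False
    proof cases
      case comp_program
      with p(3) show ?thesis by (auto simp: stable_def)
    next
      case comp_test
      with stuck show ?thesis by (blast intro: comp_step.comp_test)
    next
      case (comp_sync \<mu> p'' t')
      \<comment> \<open>The label on which \<open>q\<close> and \<open>t\<close> synchronise may
        differ from \<open>\<mu>\<close>, and so may the successor of \<open>t\<close>.\<close>
      have "\<exists>\<gamma> q'. L\<^sub>Q q (Vis (dual \<gamma>)) q' \<and> \<gamma> \<in> R T t"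
      proof (cases "\<mu> \<in> N")
        case True
        with assms(6) comp_sync show ?thesis unfolding cn_enabled_def R_def by blast
      next
        case False
        with comp_sync have "\<mu> \<in> coR dual N L\<^sub>P p'" "\<mu> \<in> R T t"
          by (auto simp: coR_def R_def)
        moreover from this sub have "ldelta A (lphi A \<mu>) \<in> coR_abs A dual N L\<^sub>Q q"
          by (auto simp: coR_abs_def)
        ultimately show ?thesis
          using abstracts_coR_R[OF assms(7), of \<mu> t q] False by (auto simp: coR_def)
      qed
      with stuck show ?thesis by (auto simp: R_def intro: comp_step.comp_sync)
    qed
  qed
qed

end
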